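(* Let $(X,\tau)$ be a topological vector space and let $F:X\to\overline{\mathbb{R}}$. Then for every $x\in X$ $$F^{lc}(x)=\inf\{\lambda\in\mathbb{R}: x\in\operatorname{co}L_\lambda(F)\}.$$
   Context: $\overline{\mathbb{R}}=[-\infty,+\infty]$, with the convention $\inf\emptyset=+\infty$. For $\lambda\in\mathbb{R}$, $L_\lambda(F)=\{x\in X:F(x)\le\lambda\}$; $\operatorname{co}S$ is the convex hull of $S$. A function $G:X\to\overline{\mathbb{R}}$ is level convex if $L_\lambda(G)$ is convex for every $\lambda\in\mathbb{R}$ (equivalently $G(tx_1+(1-t)x_2)\le\max\{G(x_1),G(x_2)\}$ for all $t\in(0,1)$, $x_1,x_2\in X$). The level convex envelope of $F$ is $F^{lc}:=\sup\{G\mid G:X\to\overline{\mathbb{R}}\text{ level convex},\ G\le F\text{ on }X\}$. *)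

theory Defs
  imports "HOL-Analysis.Analysis"
begin

text \<open>Real topological vector spaces: the topology is an explicit parameter, and no separation
  axiom is imposed.\<close>

definition topological_vector_space :: "'a::real_vector topology \<Rightarrow> bool" where
  "topological_vector_space \<tau> \<longleftrightarrow>
     topspace \<tau> = UNIV \<and>
     continuous_map (prod_topology \<tau> \<tau>) \<tau> (\<lambda>(x, y). x + y) \<and>
     continuous_map (prod_topology euclideanreal \<tau>) \<tau> (\<lambda>(c, x). c *\<^sub>R x)"

definition sublevel :: "('a \<Rightarrow> ereal) \<Rightarrow> real \<Rightarrow> 'a set" where
  "sublevel F l = {x. F x \<le> ereal l}"

definition level_convex :: "('a::real_vector \<Rightarrow> ereal) \<Rightarrow> bool" where
  "level_convex G \<longleftrightarrow> (\<forall>l::real. convex (sublevel G l))"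

text \<open>The order and the supremum on functions are the pointwise ones.\<close>

definition level_convex_envelope :: "('a::real_vector \<Rightarrow> ereal) \<Rightarrow> 'a \<Rightarrow> ereal" where
  "level_convex_envelope F = Sup {G. level_convex G \<and> G \<le> F}"

end

theory Submission
  imports Defs
begin

text \<open>The infimum on the right, as a function \<open>H\<close> of \<open>x\<close>, is itself
  the greatest level convex minorant of \<open>F\<close>. It is level convex because each of its
  sublevel sets is an intersection of convex hulls (\<open>sublevel_INF_hull\<close>). It lies below
  \<open>F\<close> because a set is contained in its hull. It dominates every level convex
  \<open>G \<le> F\<close> because a convex sublevel set of \<open>G\<close> containing that of
  \<open>F\<close> also contains its hull.\<close>

lemma sublevel_mono: "l \<le> m \<Longrightarrow> sublevel F l \<subseteq> sublevel F m"
  unfolding sublevel_def by (auto intro: order_trans)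

text \<open>The infimum need not be attained, so a bound \<open>l\<close> on it only places
  \<open>x\<close> in the hulls at levels strictly above \<open>l\<close>; these hulls grow with the
  level. The intersection form makes convexity immediate.\<close>

lemma sublevel_INF_hull:
  fixes F :: "'a::real_vector \<Rightarrow> ereal"
  shows "sublevel (\<lambda>x. INF l\<in>{l::real. x \<in> convex hull (sublevel F l)}. ereal l) l
    = (\<Inter>m\<in>{l<..}. convex hull (sublevel F m))"
    (is "sublevel ?H l = _")
proof (intro equalityI subsetI INT_I)
  fix x m assume "x \<in> sublevel ?H l" and "m \<in> {l<..}"
  then have "?H x < ereal m"
    unfolding sublevel_def by (auto intro: le_less_trans)
  then obtain k where "x \<in> convex hull (sublevel F k)" "k < m"
    by (auto simp: INF_less_iff)
  then show "x \<in> convex hull (sublevel F m)"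
    using hull_mono[OF sublevel_mono[of k m F]] by auto
next
  fix x assume x: "x \<in> (\<Inter>m\<in>{l<..}. convex hull (sublevel F m))"
  have "?H x \<le> ereal l"
  proof (rule ccontr)
    assume "\<not> ?H x \<le> ereal l"
    \<comment> \<open>A real level strictly between \<open>l\<close> and the infimum is admissible
      for \<open>x\<close>, yet lies below the infimum.\<close>
    then obtain m where "ereal l < ereal m" "ereal m < ?H x"
      using ereal_dense2[of "ereal l" "?H x"] by (auto simp: not_le)
    moreover have "?H x \<le> ereal m"
      using x \<open>ereal l < ereal m\<close> by (intro INF_lower) auto
    ultimately show False by simp
  qed
  then show "x \<in> sublevel ?H l" unfolding sublevel_def by simp
qed

theorem proposition2p7:
  fixes \<tau> :: "'a::real_vector topology" and F :: "'a \<Rightarrow> ereal"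
  assumes "topological_vector_space \<tau>"
  shows "\<forall>x. level_convex_envelope F x =
    (INF l\<in>{l::real. x \<in> convex hull (sublevel F l)}. ereal l)"
proof -
  define H where "H = (\<lambda>x. INF l\<in>{l::real. x \<in> convex hull (sublevel F l)}. ereal l)"
  have "level_convex H"
    unfolding level_convex_def H_def sublevel_INF_hull
    by (intro allI convex_INT convex_convex_hull)
  moreover have "H \<le> F"
  \<comment> \<open>Comparing through real upper bounds of \<open>F x\<close> covers infinite values
    too: if \<open>F x\<close> is \<infinity>, there is nothing to check.\<close>
  proof (rule le_funI, rule ereal_le_real)
    fix x l assume "F x \<le> ereal l"
    then have "x \<in> convex hull (sublevel F l)"
      by (intro hull_inc) (simp add: sublevel_def)
    then show "H x \<le> ereal l"
      unfolding H_def by (intro INF_lower) simp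
  qed
  moreover have "G \<le> H" if "level_convex G" "G \<le> F" for G
  proof (rule le_funI)
    fix x
    have "G x \<le> ereal l" if "x \<in> convex hull (sublevel F l)" for l
    proof -
      have "sublevel F l \<subseteq> sublevel G l"
        using \<open>G \<le> F\<close> by (auto simp: sublevel_def le_fun_def intro: order_trans)
      then have "convex hull (sublevel F l) \<subseteq> sublevel G l"
        using \<open>level_convex G\<close> by (simp add: hull_minimal level_convex_def)
      with that show ?thesis by (auto simp: sublevel_def)
    qed
    \<comment> \<open>Every admissible level bounds \<open>G x\<close> from above; if there is none,
      \<open>H x\<close> is \<infinity>.\<close>
    then show "G x \<le> H x" unfolding H_def by (intro INF_greatest) simp
  qed
  ultimately have "level_convex_envelope F = H"
    unfolding level_convex_envelope_def by (intro Sup_eqI) auto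
  then show ?thesis by (simp add: H_def)
qed

end
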